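(* Let $p\ge1$. The bicomplex Wiener algebra $\mathfrak W^{p\times p}$ is isomorphic, as an algebra, to the algebra of all bicomplex $\sharp$-symmetric elements of the complex Wiener algebra $\mathcal W^{2p\times 2p}$.
   Context: $\mathbb{BC}$ is the commutative algebra of bicomplex numbers $Z=z_1+jz_2$, $z_1,z_2\in\mathbb C$ (imaginary unit $i$), where $j^2=-1$ and $ij=ji=:k$ (so $k^2=1$). Put $\mathbf e_1=\frac{1+k}{2}$, $\mathbf e_2=\frac{1-k}{2}$; these are idempotents with $\mathbf e_1\mathbf e_2=0$, $\mathbf e_1+\mathbf e_2=1$, and every $Z=z_1+jz_2$ is uniquely $Z=\lambda_1\mathbf e_1+\lambda_2\mathbf e_2$ with $\lambda_1=z_1-iz_2$, $\lambda_2=z_1+iz_2\in\mathbb C$. Similarly every $M\in\mathbb{BC}^{p\times p}$ is uniquely $M=M_1\mathbf e_1+M_2\mathbf e_2$ with $M_1,M_2\in\mathbb C^{p\times p}$; its norm is $\|M\|=\|M_1\|+\|M_2\|$ (operator norms of complex matrices). The bicomplex unit circle is $\partial\mathbb K=\{e^{it}e^{js}: t,s\in[0,2\pi]\}\subset\mathbb{BC}$, where $e^{js}=\cos s+j\sin s$. $\mathfrak W^{p\times p}$ consists of the functions on $\partial\mathbb K$ of the form $f(Z)=\sum_{n\in\mathbb Z}f_nZ^n$ with $f_n\in\mathbb{BC}^{p\times p}$ and $\sum_{n\in\mathbb Z}\|f_n\|<\infty$, with pointwise multiplication. $\mathcal W^{2p\times2p}$ consists of the functions $f(e^{it})=\sum_{n\in\mathbb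 Z}f_ne^{int}$ with $f_n\in\mathbb C^{2p\times2p}$ and $\sum_n\|f_n\|<\infty$, with pointwise multiplication. Let $J=\begin{pmatrix}0&-1\\1&0\end{pmatrix}$ and $J_p=J\otimes I_p$ (Kronecker product). For $M\in\mathbb C^{2p\times2p}$ put $M^\sharp=J_pMJ_p^*$. An element $f\in\mathcal W^{2p\times2p}$ is bicomplex $\sharp$-symmetric if $f(e^{it})=(f(e^{it}))^\sharp$ for all $t\in[0,2\pi]$. *)

theory Defs
  imports
    "HOL-Analysis.Analysis"
    "HOL-Algebra.Module"
    "HOL-Algebra.QuotRing"
begin

section \<open>Bicomplex numbers\<close>

text \<open>\<open>Bicomplex z\<^sub>1 z\<^sub>2\<close> stands for \<open>z\<^sub>1 + j z\<^sub>2\<close>.\<close>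

datatype bicomplex = Bicomplex (bc1: complex) (bc2: complex)

lemma bicomplex_eq_iff: "Z = W \<longleftrightarrow> bc1 Z = bc1 W \<and> bc2 Z = bc2 W"
  by (cases Z; cases W) simp

instantiation bicomplex :: comm_ring_1
begin

definition zero_bicomplex_def: "0 = Bicomplex 0 0"
definition one_bicomplex_def: "1 = Bicomplex 1 0"
definition plus_bicomplex_def: "Z + W = Bicomplex (bc1 Z + bc1 W) (bc2 Z + bc2 W)"
definition minus_bicomplex_def: "Z - W = Bicomplex (bc1 Z - bc1 W) (bc2 Z - bc2 W)"
definition uminus_bicomplex_def: "- Z = Bicomplex (- bc1 Z) (- bc2 Z)"
definition times_bicomplex_def:
  "Z * W = Bicomplex (bc1 Z * bc1 W - bc2 Z * bc2 W) (bc1 Z * bc2 W + bc2 Z * bc1 W)"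

instance
  by standard
    (simp_all add: zero_bicomplex_def one_bicomplex_def plus_bicomplex_def minus_bicomplex_def
      uminus_bicomplex_def times_bicomplex_def algebra_simps)

end

lemmas bicomplex_ring_defs =
  zero_bicomplex_def one_bicomplex_def plus_bicomplex_def minus_bicomplex_def
  uminus_bicomplex_def times_bicomplex_def

text \<open>
  \<open>(z\<^sub>1 + j z\<^sub>2)(z\<^sub>1 - j z\<^sub>2) = z\<^sub>1\<^sup>2 + z\<^sub>2\<^sup>2\<close>, so \<open>Z\<close> is a unit iff this complex number is
  nonzero. On non-units \<open>inverse\<close> is \<open>0\<close> by the convention \<open>x / 0 = 0\<close>. This instance gives
  access to the integer powers \<open>Z powi n\<close>.
\<close>

instantiation bicomplex :: inverse
begin

definition inverse_bicomplex_def: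
  "inverse Z = Bicomplex (bc1 Z / ((bc1 Z)\<^sup>2 + (bc2 Z)\<^sup>2)) (- bc2 Z / ((bc1 Z)\<^sup>2 + (bc2 Z)\<^sup>2))"
definition divide_bicomplex_def: "Z div W = Z * inverse W" for Z W :: bicomplex

instance ..

end

lemma bicomplex_mult_inverse:
  assumes "(bc1 Z)\<^sup>2 + (bc2 Z)\<^sup>2 \<noteq> 0"
  shows "Z * inverse Z = 1"
  using assms
  by (simp add: times_bicomplex_def inverse_bicomplex_def one_bicomplex_def
      power2_eq_square add_divide_distrib[symmetric])

definition bc_of_complex :: "complex \<Rightarrow> bicomplex" where
  "bc_of_complex z = Bicomplex z 0"

definition bc_j :: bicomplex where
  "bc_j = Bicomplex 0 1"

definition bc_k :: bicomplex where
  "bc_k = bc_of_complex \<i> * bc_j"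

definition bc_e1 :: bicomplex where
  "bc_e1 = bc_of_complex (1/2) * (1 + bc_k)"

definition bc_e2 :: bicomplex where
  "bc_e2 = bc_of_complex (1/2) * (1 - bc_k)"

text \<open>Idempotent components: \<open>Z = \<lambda>\<^sub>1 e\<^sub>1 + \<lambda>\<^sub>2 e\<^sub>2\<close>.\<close>

definition bc_lam1 :: "bicomplex \<Rightarrow> complex" where
  "bc_lam1 Z = bc1 Z - \<i> * bc2 Z"

definition bc_lam2 :: "bicomplex \<Rightarrow> complex" where
  "bc_lam2 Z = bc1 Z + \<i> * bc2 Z"

lemma bc_j_squared: "bc_j * bc_j = -1"
  by (simp add: bc_j_def bicomplex_ring_defs)

lemma bc_k_squared: "bc_k * bc_k = 1"
  by (simp add: bc_k_def bc_j_def bc_of_complex_def bicomplex_ring_defs)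

lemma bicomplex_decomp: "Z = bc_of_complex (bc1 Z) + bc_j * bc_of_complex (bc2 Z)"
  by (simp add: bicomplex_eq_iff bc_j_def bc_of_complex_def bicomplex_ring_defs)

lemma bicomplex_idempotents:
  "bc_e1 * bc_e1 = bc_e1" "bc_e2 * bc_e2 = bc_e2" "bc_e1 * bc_e2 = 0" "bc_e1 + bc_e2 = 1"
  by (simp_all add: bc_e1_def bc_e2_def bc_k_def bc_j_def bc_of_complex_def bicomplex_ring_defs
      algebra_simps)

lemma bicomplex_idempotent_decomp_iff:
  "Z = bc_of_complex a * bc_e1 + bc_of_complex b * bc_e2 \<longleftrightarrow> a = bc_lam1 Z \<and> b = bc_lam2 Z"
proof -
  have "Z = bc_of_complex (bc_lam1 Z) * bc_e1 + bc_of_complex (bc_lam2 Z) * bc_e2" for Z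
    by (simp add: bicomplex_eq_iff bc_e1_def bc_e2_def bc_k_def bc_j_def bc_of_complex_def
        bc_lam1_def bc_lam2_def bicomplex_ring_defs field_simps)
  moreover have "bc_lam1 (bc_of_complex a * bc_e1 + bc_of_complex b * bc_e2) = a"
    by (simp add: bicomplex_eq_iff bc_e1_def bc_e2_def bc_k_def bc_j_def bc_of_complex_def
        bc_lam1_def bicomplex_ring_defs field_simps)
  moreover have "bc_lam2 (bc_of_complex a * bc_e1 + bc_of_complex b * bc_e2) = b"
    by (simp add: bicomplex_eq_iff bc_e1_def bc_e2_def bc_k_def bc_j_def bc_of_complex_def
        bc_lam2_def bicomplex_ring_defs field_simps)
  ultimately show ?thesis
    by metis
qed

instantiation bicomplex :: real_vector
begin

definition scaleR_bicomplex_def: "r *\<^sub>R Z = Bicomplex (r *\<^sub>R bc1 Z) (r *\<^sub>R bc2 Z)"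

instance
  by standard
    (simp_all add: bicomplex_eq_iff scaleR_bicomplex_def plus_bicomplex_def algebra_simps)

end

text \<open>
  The norm \<open>|\<lambda>\<^sub>1| + |\<lambda>\<^sub>2|\<close> is the matrix norm below for \<open>p = 1\<close>; it only serves to provide the
  usual topology of \<open>\<complex>\<^sup>2\<close>.
\<close>

instantiation bicomplex :: real_normed_vector
begin

definition norm_bicomplex_def: "norm Z = norm (bc_lam1 Z) + norm (bc_lam2 Z)"
definition sgn_bicomplex_def: "sgn Z = Z /\<^sub>R norm Z" for Z :: bicomplex
definition dist_bicomplex_def: "dist Z W = norm (Z - W)" for Z W :: bicomplex
definition uniformity_bicomplex_def:
  "(uniformity :: (bicomplex \<times> bicomplex) filter) =
     (INF e\<in>{0 <..}. principal {(Z, W). dist Z W < e})"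
definition open_bicomplex_def:
  "open (U :: bicomplex set) \<longleftrightarrow> (\<forall>Z\<in>U. eventually (\<lambda>(Z', W). Z' = Z \<longrightarrow> W \<in> U) uniformity)"

instance
proof
  fix a :: real and Z W :: bicomplex and U :: "bicomplex set"
  show "sgn Z = Z /\<^sub>R norm Z" "dist Z W = norm (Z - W)"
    by (simp_all add: sgn_bicomplex_def dist_bicomplex_def)
  show "(uniformity :: (bicomplex \<times> bicomplex) filter) =
     (INF e\<in>{0 <..}. principal {(Z, W). dist Z W < e})"
    by (rule uniformity_bicomplex_def)
  show "open U \<longleftrightarrow> (\<forall>Z\<in>U. eventually (\<lambda>(Z', W). Z' = Z \<longrightarrow> W \<in> U) uniformity)"
    by (rule open_bicomplex_def)
  show "norm Z = 0 \<longleftrightarrow> Z = 0"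
  proof
    assume "norm Z = 0"
    then have "bc_lam1 Z = 0" "bc_lam2 Z = 0"
      by (simp_all add: norm_bicomplex_def add_nonneg_eq_0_iff)
    then show "Z = 0"
      by (auto simp: bicomplex_eq_iff zero_bicomplex_def bc_lam1_def bc_lam2_def)
  qed (simp add: norm_bicomplex_def zero_bicomplex_def bc_lam1_def bc_lam2_def)
  have "bc_lam1 (Z + W) = bc_lam1 Z + bc_lam1 W" "bc_lam2 (Z + W) = bc_lam2 Z + bc_lam2 W"
    by (simp_all add: bc_lam1_def bc_lam2_def plus_bicomplex_def algebra_simps)
  then show "norm (Z + W) \<le> norm Z + norm W"
    using norm_triangle_ineq[of "bc_lam1 Z" "bc_lam1 W"]
      norm_triangle_ineq[of "bc_lam2 Z" "bc_lam2 W"]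
    by (simp add: norm_bicomplex_def)
  have "bc_lam1 (a *\<^sub>R Z) = a *\<^sub>R bc_lam1 Z" "bc_lam2 (a *\<^sub>R Z) = a *\<^sub>R bc_lam2 Z"
    by (simp_all add: bc_lam1_def bc_lam2_def scaleR_bicomplex_def algebra_simps)
  then show "norm (a *\<^sub>R Z) = \<bar>a\<bar> * norm Z"
    by (simp add: norm_bicomplex_def algebra_simps)
qed

end

definition bc_circle :: "bicomplex set" where
  "bc_circle =
    {bc_of_complex (cis t) * (bc_of_complex (of_real (cos s)) + bc_j * bc_of_complex (of_real (sin s)))
      | t s. t \<in> {0..2*pi} \<and> s \<in> {0..2*pi}}"

lemma bc_circle_mult_inverse:
  assumes "Z \<in> bc_circle"
  shows "Z * inverse Z = 1"
proof -
  obtain t s where Z: "Z = bc_of_complex (cis t) *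
      (bc_of_complex (of_real (cos s)) + bc_j * bc_of_complex (of_real (sin s)))"
    using assms by (auto simp: bc_circle_def)
  have "(bc1 Z)\<^sup>2 + (bc2 Z)\<^sup>2 = (cis t)\<^sup>2 * of_real ((cos s)\<^sup>2 + (sin s)\<^sup>2)"
    unfolding Z
    by (simp add: bc_of_complex_def bc_j_def bicomplex_ring_defs power_mult_distrib algebra_simps
        del: sin_cos_squared_add sin_cos_squared_add2)
  then have "(bc1 Z)\<^sup>2 + (bc2 Z)\<^sup>2 \<noteq> 0"
    by simp
  then show ?thesis
    by (rule bicomplex_mult_inverse)
qed


section \<open>Matrices\<close>

text \<open>
  The norm of the library on \<open>complex^'n^'n\<close> is the Frobenius norm; the operator norm is \<open>onorm\<close>
  with respect to the Euclidean norm of \<open>complex^'n\<close>.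
\<close>

definition op_norm :: "complex^'n^'n \<Rightarrow> real" where
  "op_norm M = onorm (\<lambda>x. M *v x)"

definition bc_mat_norm :: "bicomplex^'p^'p \<Rightarrow> real" where
  "bc_mat_norm M = op_norm (\<chi> i k. bc_lam1 (M $ i $ k)) + op_norm (\<chi> i k. bc_lam2 (M $ i $ k))"

definition conj_transpose :: "complex^'n^'m \<Rightarrow> complex^'m^'n" where
  "conj_transpose M = (\<chi> i k. cnj (M $ k $ i))"

text \<open>
  Row \<open>(a, i)\<close>, column \<open>(b, k)\<close> of \<open>A \<otimes> B\<close> holds \<open>A\<^sub>a\<^sub>b B\<^sub>i\<^sub>k\<close>, so the index type \<open>2 \<times> 'p\<close> plays
  the role of \<open>{1, \<dots>, 2p}\<close>.
\<close>

definition kronecker ::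
  "complex^'b^'a \<Rightarrow> complex^'k^'i \<Rightarrow> complex^('b::finite \<times> 'k::finite)^('a::finite \<times> 'i::finite)" where
  "kronecker A B = (\<chi> r c. A $ fst r $ fst c * B $ snd r $ snd c)"

definition J_matrix :: "complex^2^2" where
  "J_matrix = vector [vector [0, -1], vector [1, 0]]"

definition J_p :: "complex^(2 \<times> 'p::finite)^(2 \<times> 'p)" where
  "J_p = kronecker J_matrix (mat 1 :: complex^'p^'p)"

definition sharp :: "complex^(2 \<times> 'p::finite)^(2 \<times> 'p) \<Rightarrow> complex^(2 \<times> 'p)^(2 \<times> 'p)" where
  "sharp M = J_p ** M ** conj_transpose J_p"


section \<open>Algebras and their isomorphisms\<close>

definition complex_ring :: "complex ring" where
  "complex_ring = \<lparr>carrier = UNIV, monoid.mult = (*), one = 1, ring.zero = 0, add = (+)\<rparr>"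

text \<open>
  The locale \<open>algebra\<close> of the library demands a commutative multiplication. This is the notion of
  a unital associative algebra over the complex numbers.
\<close>

definition complex_algebra :: "(complex, 'a) module \<Rightarrow> bool" where
  "complex_algebra A \<longleftrightarrow> ring A \<and> Module.module complex_ring A \<and>
    (\<forall>c. \<forall>x\<in>carrier A. \<forall>y\<in>carrier A.
      (c \<odot>\<^bsub>A\<^esub> x) \<otimes>\<^bsub>A\<^esub> y = c \<odot>\<^bsub>A\<^esub> (x \<otimes>\<^bsub>A\<^esub> y) \<and>
      x \<otimes>\<^bsub>A\<^esub> (c \<odot>\<^bsub>A\<^esub> y) = c \<odot>\<^bsub>A\<^esub> (x \<otimes>\<^bsub>A\<^esub> y))"

definition algebra_iso ::
  "(complex, 'a) module \<Rightarrow> (complex, 'b) module \<Rightarrow> ('a \<Rightarrow> 'b) set" where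
  "algebra_iso A B =
    {h \<in> ring_iso A B. \<forall>c. \<forall>x\<in>carrier A. h (c \<odot>\<^bsub>A\<^esub> x) = c \<odot>\<^bsub>B\<^esub> h x}"

definition algebra_isomorphic ::
  "(complex, 'a) module \<Rightarrow> (complex, 'b) module \<Rightarrow> bool" where
  "algebra_isomorphic A B \<longleftrightarrow>
    complex_algebra A \<and> complex_algebra B \<and> algebra_iso A B \<noteq> {}"

text \<open>
  Pointwise operations on a set \<open>F\<close> of matrix-valued functions with domain \<open>D\<close>; \<open>\<iota>\<close> embeds the
  complex scalars into the ring of matrix entries. Functions with domain \<open>D\<close> are represented by
  elements of \<open>extensional D\<close>.
\<close>

definition pointwise_algebra ::
  "(complex \<Rightarrow> 'a::comm_ring_1) \<Rightarrow> 'z set \<Rightarrow> ('z \<Rightarrow> 'a^'n^'n) set \<Rightarrow>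
    (complex, 'z \<Rightarrow> 'a^'n^'n) module" where
  "pointwise_algebra \<iota> D F =
    \<lparr>carrier = F,
     monoid.mult = (\<lambda>f g. \<lambda>z\<in>D. f z ** g z),
     one = (\<lambda>z\<in>D. mat 1),
     ring.zero = (\<lambda>z\<in>D. 0),
     add = (\<lambda>f g. \<lambda>z\<in>D. f z + g z),
     smult = (\<lambda>c f. \<lambda>z\<in>D. mat (\<iota> c) ** f z)\<rparr>"


section \<open>The two Wiener algebras\<close>

definition bc_wiener_set :: "(bicomplex \<Rightarrow> bicomplex^'p^'p) set" where
  "bc_wiener_set =
    {f \<in> extensional bc_circle.
      \<exists>a :: int \<Rightarrow> bicomplex^'p^'p.
        (\<lambda>n. bc_mat_norm (a n)) summable_on UNIV \<and>
        (\<forall>Z\<in>bc_circle. ((\<lambda>n. a n ** mat (Z powi n)) has_sum f Z) UNIV)}"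

definition bc_wiener_algebra :: "(complex, bicomplex \<Rightarrow> bicomplex^'p^'p) module" where
  "bc_wiener_algebra = pointwise_algebra bc_of_complex bc_circle bc_wiener_set"

definition wiener_set :: "(complex \<Rightarrow> complex^'n^'n) set" where
  "wiener_set =
    {f \<in> extensional (sphere 0 1).
      \<exists>a :: int \<Rightarrow> complex^'n^'n.
        (\<lambda>n. op_norm (a n)) summable_on UNIV \<and>
        (\<forall>t\<in>{0..2*pi}. ((\<lambda>n. a n ** mat (cis (of_int n * t))) has_sum f (cis t)) UNIV)}"

definition sharp_symmetric :: "(complex \<Rightarrow> complex^(2 \<times> 'p::finite)^(2 \<times> 'p)) \<Rightarrow> bool" where
  "sharp_symmetric f \<longleftrightarrow> (\<forall>t\<in>{0..2*pi}. f (cis t) = sharp (f (cis t)))"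

definition sharp_symmetric_wiener_algebra ::
  "(complex, complex \<Rightarrow> complex^(2 \<times> 'p::finite)^(2 \<times> 'p)) module" where
  "sharp_symmetric_wiener_algebra =
    pointwise_algebra (\<lambda>c. c) (sphere 0 1) {f \<in> wiener_set. sharp_symmetric f}"

end

theory Submission
  imports Defs
begin

text \<open>
  In idempotent coordinates the circle \<open>\<partial>K\<close> is the torus \<open>|\<lambda>\<^sub>1| = |\<lambda>\<^sub>2| = 1\<close>, and an element of the
  bicomplex Wiener algebra has the form \<open>f(Z) = F\<^sub>1(\<lambda>\<^sub>1) e\<^sub>1 + F\<^sub>2(\<lambda>\<^sub>2) e\<^sub>2\<close> with \<open>F\<^sub>1\<close>, \<open>F\<^sub>2\<close> in the
  complex Wiener algebra. Hence \<open>f\<close> is determined by its restriction to the ordinary unit circle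
  \<open>\<lambda>\<^sub>1 = \<lambda>\<^sub>2 = e\<^sup>i\<^sup>t\<close>, and \<open>F\<^sub>1\<close>, \<open>F\<^sub>2\<close> can be prescribed there arbitrarily. On the other side,
  \<open>M = M\<^sup>\<sharp>\<close> means that \<open>M\<close> has block rows \<open>(A, -B)\<close> and \<open>(B, A)\<close>, which is the matrix of the
  bicomplex matrix \<open>A + j B\<close>. Restricting \<open>f\<close> to the ordinary circle and applying this
  representation is the isomorphism; no uniqueness of Fourier coefficients is needed.
\<close>

section \<open>Scalar Wiener functions\<close>

text \<open>Values off the circle are left arbitrary, so closure properties can be stated for plain
  lambda terms.\<close>

definition scalar_wiener :: "(complex \<Rightarrow> complex) set" where
  "scalar_wiener = {g. \<exists>a :: int \<Rightarrow> complex. (\<lambda>n. norm (a n)) summable_on UNIV \<and>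
     (\<forall>z\<in>sphere 0 1. ((\<lambda>n. a n * z powi n) has_sum g z) UNIV)}"

section \<open>Closure properties of scalar Wiener functions\<close>

lemma scalar_wiener_cong:
  assumes "g \<in> scalar_wiener" "\<And>z. z \<in> sphere 0 1 \<Longrightarrow> g z = h z"
  shows "h \<in> scalar_wiener"
  using assms unfolding scalar_wiener_def by (simp add: Ball_def)

lemma scalar_wiener_const: "(\<lambda>z. c) \<in> scalar_wiener"
proof -
  define a :: "int \<Rightarrow> complex" where "a n = (if n = 0 then c else 0)" for n
  have "(\<lambda>n. norm (a n)) summable_on {0}"
    by simp
  then have "(\<lambda>n. norm (a n)) summable_on UNIV"
    by (rule summable_on_cong_neutral[THEN iffD1, rotated -1]) (auto simp: a_def)
  moreover have "((\<lambda>n. a n * z powi n) has_sum c) UNIV" for z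
    by (rule has_sum_finite_neutralI[of "{0}"]) (auto simp: a_def)
  ultimately show ?thesis
    unfolding scalar_wiener_def by blast
qed

lemma scalar_wiener_add:
  assumes "f \<in> scalar_wiener" "g \<in> scalar_wiener"
  shows "(\<lambda>z. f z + g z) \<in> scalar_wiener"
proof -
  obtain a b where a: "(\<lambda>n. norm (a n :: complex)) summable_on (UNIV :: int set)"
      "\<And>z. z \<in> sphere 0 1 \<Longrightarrow> ((\<lambda>n. a n * z powi n) has_sum f z) UNIV"
    and b: "(\<lambda>n. norm (b n :: complex)) summable_on (UNIV :: int set)"
      "\<And>z. z \<in> sphere 0 1 \<Longrightarrow> ((\<lambda>n. b n * z powi n) has_sum g z) UNIV"
    using assms unfolding scalar_wiener_def by auto
  have "(\<lambda>n. norm (a n + b n)) summable_on UNIV"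
    by (rule Infinite_Sum.abs_summable_on_comparison_test'[OF summable_on_add[OF a(1) b(1)]])
      (rule norm_triangle_ineq)
  moreover have "((\<lambda>n. (a n + b n) * z powi n) has_sum (f z + g z)) UNIV"
    if "z \<in> sphere 0 1" for z
    using has_sum_add[OF a(2)[OF that] b(2)[OF that]] by (simp add: algebra_simps)
  ultimately show ?thesis
    unfolding scalar_wiener_def mem_Collect_eq by (intro exI[of _ "\<lambda>n. a n + b n"]) blast
qed

lemma scalar_wiener_mult:
  assumes "f \<in> scalar_wiener" "g \<in> scalar_wiener"
  shows "(\<lambda>z. f z * g z) \<in> scalar_wiener"
proof -
  obtain a b where a: "(\<lambda>n. norm (a n :: complex)) summable_on (UNIV :: int set)"
      "\<And>z. z \<in> sphere 0 1 \<Longrightarrow> ((\<lambda>n. a n * z powi n) has_sum f z) UNIV"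
    and b: "(\<lambda>n. norm (b n :: complex)) summable_on (UNIV :: int set)"
      "\<And>z. z \<in> sphere 0 1 \<Longrightarrow> ((\<lambda>n. b n * z powi n) has_sum g z) UNIV"
    using assms unfolding scalar_wiener_def by auto
  \<comment> \<open>Cauchy product: the double series is resummed along the lines of constant total degree \<open>k\<close>.\<close>
  define P :: "int \<times> int \<Rightarrow> complex" where "P = (\<lambda>(k, n). a n * b (k - n))"
  define c where "c k = (\<Sum>\<^sub>\<infinity>n. P (k, n))" for k
  \<comment> \<open>\<open>\<tau>\<close> sends a total degree and a first exponent to the two
    exponents; it carries absolute summability of the product family over to
    \<open>P\<close>.\<close>
  define \<tau> :: "int \<times> int \<Rightarrow> int \<times> int" where "\<tau> = (\<lambda>(k, n). (n, k - n))"
  have \<tau>: "bij_betw \<tau> (UNIV \<times> UNIV) (UNIV \<times> UNIV)"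
    by (rule bij_betwI[where g = "\<lambda>(n, m). (n + m, n)"]) (auto simp: \<tau>_def)
  have prod_summable: "(\<lambda>x. norm (case x of (n, m) \<Rightarrow> a n * b m)) summable_on UNIV \<times> UNIV"
    unfolding Infinite_Sum.abs_summable_on_Sigma_iff
    using a(1) b(1)
    by (auto simp: norm_mult infsum_cmult_right' summable_on_cmult_right'
        abs_mult infsum_nonneg intro!: summable_on_cmult_right summable_on_cmult_left)
  have P_eq: "P x = (case \<tau> x of (n, m) \<Rightarrow> a n * b m)" for x
    by (simp add: P_def \<tau>_def split: prod.splits)
  have P_summable: "(\<lambda>x. norm (P x)) summable_on UNIV \<times> UNIV"
    using prod_summable summable_on_reindex_bij_betw[OF \<tau>, of "\<lambda>x. norm (case x of (n, m) \<Rightarrow> a n * b m)"]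
    by (simp add: P_eq)
  have row: "(\<lambda>n. norm (P (k, n))) summable_on UNIV" for k
    using P_summable unfolding Infinite_Sum.abs_summable_on_Sigma_iff by auto
  have "(\<lambda>k. \<Sum>\<^sub>\<infinity>n. norm (P (k, n))) summable_on UNIV"
    using P_summable unfolding Infinite_Sum.abs_summable_on_Sigma_iff
    by (simp add: infsum_nonneg)
  \<comment> \<open>By the triangle inequality the norm of \<open>c k\<close> is at most the sum of
    the norms along row \<open>k\<close>.\<close>
  then have "(\<lambda>k. norm (c k)) summable_on UNIV"
    by (rule Infinite_Sum.abs_summable_on_comparison_test') (simp add: c_def norm_infsum_bound row)
  moreover have "((\<lambda>k. c k * z powi k) has_sum (f z * g z)) UNIV" if z: "z \<in> sphere 0 1" for z
  proof -
    have nz: "z \<noteq> 0" and norm_z: "norm (z powi k) = 1" for k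
      using z by (auto simp: norm_power_int)
    let ?Q = "\<lambda>(n, m). (a n * z powi n) * (b m * z powi m)"
    \<comment> \<open>Powers of \<open>z\<close> have norm 1, so these terms have the norms of the
      products \<open>a n * b m\<close>.\<close>
    have "(\<lambda>x. norm (?Q x)) summable_on UNIV \<times> UNIV"
      by (rule Infinite_Sum.abs_summable_on_comparison_test[OF prod_summable])
        (auto simp: norm_mult norm_z)
    then have "?Q summable_on UNIV \<times> UNIV"
      by (rule abs_summable_summable)
    \<comment> \<open>Summing over \<open>m\<close> first gives \<open>a n * z powi n * g z\<close>;
      summing that over \<open>n\<close> gives the product.\<close>
    then have "(?Q has_sum (f z * g z)) (UNIV \<times> UNIV)"
      using has_sum_cmult_right[OF b(2)[OF z]] has_sum_cmult_left[OF a(2)[OF z]]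
      by (intro has_sum_SigmaI[where g = "\<lambda>n. a n * z powi n * g z"]) auto
    then have "((\<lambda>x. ?Q (\<tau> x)) has_sum (f z * g z)) (UNIV \<times> UNIV)"
      by (simp only: has_sum_reindex_bij_betw[OF \<tau>])
    moreover have "?Q (\<tau> x) = P x * z powi fst x" for x
      using power_int_add[of z "snd x" "fst x - snd x"] nz
      by (simp add: P_def \<tau>_def split: prod.splits)
    ultimately have "((\<lambda>x. P x * z powi fst x) has_sum (f z * g z)) (UNIV \<times> UNIV)"
      by simp
    moreover have "((\<lambda>n. P (k, n) * z powi fst (k, n)) has_sum (c k * z powi k)) UNIV" for k
      using has_sum_cmult_left[OF has_sum_infsum[OF abs_summable_summable[OF row[of k]]]]
      by (simp add: c_def)
    ultimately show ?thesis
      by (rule has_sum_SigmaD)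
  qed
  ultimately show ?thesis
    unfolding scalar_wiener_def by blast
qed

lemma scalar_wiener_minus: "f \<in> scalar_wiener \<Longrightarrow> (\<lambda>z. - f z) \<in> scalar_wiener"
  using scalar_wiener_mult[OF scalar_wiener_const[of "-1"]] by simp

lemma scalar_wiener_diff:
  "f \<in> scalar_wiener \<Longrightarrow> g \<in> scalar_wiener \<Longrightarrow> (\<lambda>z. f z - g z) \<in> scalar_wiener"
  using scalar_wiener_add[OF _ scalar_wiener_minus] by fastforce

lemma scalar_wiener_sum:
  "(\<And>i. i \<in> I \<Longrightarrow> f i \<in> scalar_wiener) \<Longrightarrow> (\<lambda>z. \<Sum>i\<in>I. f i z) \<in> scalar_wiener"
  by (induction I rule: infinite_finite_induct)
    (auto intro: scalar_wiener_add scalar_wiener_const)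


section \<open>Entrywise description of the complex Wiener algebra\<close>

lemma has_sum_vec_iff:
  fixes f :: "'i \<Rightarrow> 'a::{comm_monoid_add, topological_space} ^ 'n"
  shows "(f has_sum s) A \<longleftrightarrow> (\<forall>i. ((\<lambda>x. f x $ i) has_sum s $ i) A)"
proof
  assume "(f has_sum s) A"
  then show "\<forall>i. ((\<lambda>x. f x $ i) has_sum s $ i) A"
    unfolding has_sum_def by (auto dest: tendsto_vec_nth)
next
  assume "\<forall>i. ((\<lambda>x. f x $ i) has_sum s $ i) A"
  then show "(f has_sum s) A"
    unfolding has_sum_def by (intro vec_tendstoI) simp
qed

lemma matrix_mul_mat_nth: "(M ** mat c) $ i $ k = M $ i $ k * c"
  for M :: "'a::comm_semiring_1^'n^'m"
  by (simp add: matrix_matrix_mult_def mat_def if_distrib[of "\<lambda>x. _ * x"] cong: if_cong)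

lemma mat_matrix_mul_nth: "(mat c ** M) $ i $ k = c * M $ i $ k"
  for M :: "'a::comm_semiring_1^'n^'m"
  by (simp add: matrix_matrix_mult_def mat_def if_distrib[of "\<lambda>x. x * _"] cong: if_cong)

text \<open>The entry is a coordinate of the image of the unit vector
  \<open>axis k 1\<close>.\<close>

lemma norm_nth_le_op_norm: "norm (M $ i $ k) \<le> op_norm M"
proof -
  have "M $ i $ k = (M *v axis k 1) $ i"
    by (simp add: matrix_vector_mult_def axis_def if_distrib[of "\<lambda>x. _ * x"] cong: if_cong)
  also have "norm \<dots> \<le> norm (M *v axis k 1)"
    by (rule Finite_Cartesian_Product.norm_nth_le)
  also have "\<dots> \<le> op_norm M"
    using onorm[OF matrix_vector_mul_bounded_linear, of M "axis k 1"]
    by (simp add: op_norm_def)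
  finally show ?thesis .
qed

text \<open>The Euclidean norm of \<open>M *v x\<close> is bounded by the sum of the norms of its
  coordinates, and every coordinate of \<open>x\<close> by \<open>norm x\<close>.\<close>

lemma op_norm_le_sum:
  fixes M :: "complex^'n^'n"
  shows "op_norm M \<le> (\<Sum>i\<in>UNIV. \<Sum>k\<in>UNIV. norm (M $ i $ k))"
  unfolding op_norm_def
proof (rule onorm_le)
  fix x :: "complex^'n"
  have "norm (M *v x) \<le> (\<Sum>i\<in>UNIV. norm ((M *v x) $ i))"
    by (simp add: norm_vec_def L2_set_le_sum)
  also have "\<dots> \<le> (\<Sum>i\<in>UNIV. \<Sum>k\<in>UNIV. norm (M $ i $ k) * norm x)"
    unfolding matrix_vector_mult_def
    by (intro sum_mono)
      (auto simp: norm_mult intro!: sum_norm_le mult_left_mono Finite_Cartesian_Product.norm_nth_le)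
  finally show "norm (M *v x) \<le> (\<Sum>i\<in>UNIV. \<Sum>k\<in>UNIV. norm (M $ i $ k)) * norm x"
    by (simp add: sum_distrib_right)
qed

lemma op_norm_nonneg: "0 \<le> op_norm M"
  by (rule order_trans[OF norm_ge_zero norm_nth_le_op_norm])

lemma summable_on_finite_sum:
  fixes f :: "'j \<Rightarrow> 'i \<Rightarrow> 'a::topological_comm_monoid_add"
  shows "(\<And>j. j \<in> J \<Longrightarrow> f j summable_on A) \<Longrightarrow> (\<lambda>x. \<Sum>j\<in>J. f j x) summable_on A"
  by (induction J rule: infinite_finite_induct) (auto intro: summable_on_add)

text \<open>The operator norm dominates each entry and is dominated by the finite sum of all entry
  norms, so summability reduces to scalar series.\<close>

lemma summable_op_norm_iff:
  "(\<lambda>n. op_norm (a n)) summable_on A \<longleftrightarrow> (\<forall>i k. (\<lambda>n. norm (a n $ i $ k)) summable_on A)"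
proof safe
  fix i k
  assume "(\<lambda>n. op_norm (a n)) summable_on A"
  then show "(\<lambda>n. norm (a n $ i $ k)) summable_on A"
    by (rule Infinite_Sum.abs_summable_on_comparison_test') (rule norm_nth_le_op_norm)
next
  assume "\<forall>i k. (\<lambda>n. norm (a n $ i $ k)) summable_on A"
  then have "(\<lambda>n. \<Sum>i\<in>UNIV. \<Sum>k\<in>UNIV. norm (a n $ i $ k)) summable_on A"
    by (intro summable_on_finite_sum) auto
  then have "(\<lambda>n. norm (op_norm (a n))) summable_on A"
    by (rule Infinite_Sum.abs_summable_on_comparison_test') (simp add: op_norm_nonneg op_norm_le_sum)
  then show "(\<lambda>n. op_norm (a n)) summable_on A"
    by (simp add: op_norm_nonneg)
qed

lemma cis_image_circle: "cis ` {0..2*pi} = sphere 0 1"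
proof (intro equalityI subsetI)
  fix z :: complex assume "z \<in> sphere 0 1"
  then obtain t where "0 \<le> t" "t < 2 * pi" "z = Complex (cos t) (sin t)"
    using complex_unimodular_polar[of z] by auto
  then have "z = cis t" "t \<in> {0..2*pi}"
    by (simp_all add: complex_eq_iff)
  then show "z \<in> cis ` {0..2*pi}"
    by blast
qed auto

lemma ball_sphere_iff_cis: "(\<forall>z\<in>sphere 0 1. P z) \<longleftrightarrow> (\<forall>t\<in>{0..2*pi}. P (cis t))"
  unfolding cis_image_circle[symmetric] by simp

text \<open>Both the norm condition and the convergence condition split into entries, and
  coefficient sequences chosen for the separate entries assemble into one sequence of matrices.
  Coefficients can be ignored from here on.\<close>

lemma wiener_set_iff:
  "f \<in> wiener_set \<longleftrightarrow>
    f \<in> extensional (sphere 0 1) \<and> (\<forall>i k. (\<lambda>z. f z $ i $ k) \<in> scalar_wiener)"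
proof -
  have *: "(\<forall>t\<in>{0..2*pi}. ((\<lambda>n. a n ** mat (cis (of_int n * t))) has_sum f (cis t)) UNIV) \<longleftrightarrow>
     (\<forall>i k. \<forall>z\<in>sphere 0 1. ((\<lambda>n. a n $ i $ k * z powi n) has_sum f z $ i $ k) UNIV)"
    for a :: "int \<Rightarrow> complex^'a^'a"
    by (auto simp: ball_sphere_iff_cis cis_power_int has_sum_vec_iff matrix_mul_mat_nth)
  show ?thesis
  proof (intro iffI conjI allI; (elim conjE)?)
    assume f: "f \<in> wiener_set"
    then show "f \<in> extensional (sphere 0 1)"
      unfolding wiener_set_def by simp
    fix i k
    from f obtain a :: "int \<Rightarrow> complex^'a^'a" where
      "(\<lambda>n. op_norm (a n)) summable_on UNIV"
      "\<forall>t\<in>{0..2*pi}. ((\<lambda>n. a n ** mat (cis (of_int n * t))) has_sum f (cis t)) UNIV"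
      unfolding wiener_set_def by auto
    then show "(\<lambda>z. f z $ i $ k) \<in> scalar_wiener"
      unfolding * summable_op_norm_iff scalar_wiener_def mem_Collect_eq by (intro exI[of _ "\<lambda>n. a n $ i $ k"]) simp
  next
    assume ext: "f \<in> extensional (sphere 0 1)"
      and "\<forall>i k. (\<lambda>z. f z $ i $ k) \<in> scalar_wiener"
    then obtain a where a: "\<And>i k. (\<lambda>n. norm (a i k n :: complex)) summable_on (UNIV :: int set)"
      "\<And>i k z. z \<in> sphere 0 1 \<Longrightarrow> ((\<lambda>n. a i k n * z powi n) has_sum f z $ i $ k) UNIV"
      unfolding scalar_wiener_def mem_Collect_eq by metis
    show "f \<in> wiener_set"
      unfolding wiener_set_def * summable_op_norm_iff mem_Collect_eq
      using a ext by (intro conjI exI[of _ "\<lambda>n. \<chi> i k. a i k n"]) auto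
  qed
qed


section \<open>Entrywise description of the bicomplex Wiener algebra\<close>

text \<open>The element a e1 + b e2 in the coordinates of 1 and j: the inverse of passing to
  idempotent components.\<close>

definition bc_combine :: "complex \<Rightarrow> complex \<Rightarrow> bicomplex" where
  "bc_combine a b = Bicomplex ((a + b) / 2) (\<i> * (a - b) / 2)"

section \<open>Idempotent components: algebra and convergence\<close>

lemma bc_lam_combine [simp]: "bc_lam1 (bc_combine a b) = a" "bc_lam2 (bc_combine a b) = b"
  by (simp_all add: bc_lam1_def bc_lam2_def bc_combine_def field_simps)

lemma bc_combine_lam [simp]: "bc_combine (bc_lam1 Z) (bc_lam2 Z) = Z"
  by (simp add: bc_lam1_def bc_lam2_def bc_combine_def bicomplex_eq_iff field_simps)

lemma bc_eq_iff_lam: "Z = W \<longleftrightarrow> bc_lam1 Z = bc_lam1 W \<and> bc_lam2 Z = bc_lam2 W"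
  by (metis bc_combine_lam)

lemma bc_lam_of_complex [simp]: "bc_lam1 (bc_of_complex z) = z" "bc_lam2 (bc_of_complex z) = z"
  by (simp_all add: bc_lam1_def bc_lam2_def bc_of_complex_def)

lemma bc_lam_ring_hom [simp]:
  "bc_lam1 0 = 0" "bc_lam2 0 = 0" "bc_lam1 1 = 1" "bc_lam2 1 = 1"
  "bc_lam1 (Z + W) = bc_lam1 Z + bc_lam1 W" "bc_lam2 (Z + W) = bc_lam2 Z + bc_lam2 W"
  "bc_lam1 (Z * W) = bc_lam1 Z * bc_lam1 W" "bc_lam2 (Z * W) = bc_lam2 Z * bc_lam2 W"
  by (simp_all add: bc_lam1_def bc_lam2_def bicomplex_ring_defs algebra_simps)

lemma bc_lam_scaleR [simp]:
  "bc_lam1 (r *\<^sub>R Z) = r *\<^sub>R bc_lam1 Z" "bc_lam2 (r *\<^sub>R Z) = r *\<^sub>R bc_lam2 Z"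
  by (simp_all add: bc_lam1_def bc_lam2_def scaleR_bicomplex_def algebra_simps)

lemma bc_lam_power [simp]: "bc_lam1 (Z ^ n) = bc_lam1 Z ^ n" "bc_lam2 (Z ^ n) = bc_lam2 Z ^ n"
  by (induction n) simp_all

lemma bounded_linear_bc_lam: "bounded_linear bc_lam1" "bounded_linear bc_lam2"
  by (rule bounded_linear_intro[where K = 1]; simp add: norm_bicomplex_def)+

lemma has_sum_bicomplex_iff:
  "(f has_sum s) A \<longleftrightarrow>
    ((\<lambda>x. bc_lam1 (f x)) has_sum bc_lam1 s) A \<and> ((\<lambda>x. bc_lam2 (f x)) has_sum bc_lam2 s) A"
proof (intro iffI; (elim conjE)?)
  assume "(f has_sum s) A"
  then show "((\<lambda>x. bc_lam1 (f x)) has_sum bc_lam1 s) A \<and> ((\<lambda>x. bc_lam2 (f x)) has_sum bc_lam2 s) A"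
    by (simp add: bounded_linear_bc_lam has_sum_bounded_linear)
next
  assume *: "((\<lambda>x. bc_lam1 (f x)) has_sum bc_lam1 s) A" "((\<lambda>x. bc_lam2 (f x)) has_sum bc_lam2 s) A"
  \<comment> \<open>The two component sums are mapped back along the bounded embeddings of the
    complex numbers as multiples of e1 and of e2, then added.\<close>
  have split: "bc_combine (bc_lam1 Z) 0 + bc_combine 0 (bc_lam2 Z) = Z" for Z
    by (simp add: bc_eq_iff_lam)
  have "bounded_linear (\<lambda>a. bc_combine a 0)" "bounded_linear (bc_combine 0)"
    by (rule bounded_linear_intro[where K = 1]; simp add: bc_eq_iff_lam norm_bicomplex_def)+
  from has_sum_add[OF has_sum_bounded_linear[OF this(1) *(1)] has_sum_bounded_linear[OF this(2) *(2)]]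
  show "(f has_sum s) A"
    by (simp only: split)
qed

text \<open>The components of exp(it) exp(js) are exp(i(t - s)) and exp(i(t + s)).\<close>

lemma bc_circle_lam:
  assumes "Z \<in> bc_circle"
  shows "bc_lam1 Z \<in> sphere 0 1" "bc_lam2 Z \<in> sphere 0 1"
proof -
  obtain t s where Z: "Z = bc_of_complex (cis t) *
      (bc_of_complex (of_real (cos s)) + bc_j * bc_of_complex (of_real (sin s)))"
    using assms by (auto simp: bc_circle_def)
  have "bc_lam1 Z = cis t * cis (- s)" "bc_lam2 Z = cis t * cis s"
    unfolding Z by (auto simp: bc_lam1_def bc_lam2_def bc_j_def bc_of_complex_def
        bicomplex_ring_defs complex_eq_iff algebra_simps)
  then show "bc_lam1 Z \<in> sphere 0 1" "bc_lam2 Z \<in> sphere 0 1"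
    by (simp_all add: norm_mult)
qed

text \<open>Take s = 0. These points form the diagonal of the torus, where both components equal
  \<open>z\<close>.\<close>

lemma bc_of_complex_in_bc_circle:
  assumes "z \<in> sphere 0 1"
  shows "bc_of_complex z \<in> bc_circle"
proof -
  obtain t where "t \<in> {0..2*pi}" "z = cis t"
    using assms cis_image_circle by blast
  moreover have "bc_of_complex z = bc_of_complex z *
      (bc_of_complex (of_real (cos 0)) + bc_j * bc_of_complex (of_real (sin 0)))"
    by (simp add: bc_eq_iff_lam)
  moreover have "(0::real) \<in> {0..2*pi}"
    by simp
  ultimately show ?thesis
    unfolding bc_circle_def by blast
qed

text \<open>For negative exponents the membership in \<open>bc_circle\<close> matters: there
  \<open>inverse Z\<close> is a genuine inverse, and ring homomorphisms preserve it.\<close>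

lemma bc_lam_power_int:
  assumes "Z \<in> bc_circle"
  shows "bc_lam1 (Z powi n) = bc_lam1 Z powi n" "bc_lam2 (Z powi n) = bc_lam2 Z powi n"
proof -
  have "bc_lam1 Z * bc_lam1 (inverse Z) = 1" "bc_lam2 Z * bc_lam2 (inverse Z) = 1"
    using bc_circle_mult_inverse[OF assms] bc_lam_ring_hom by metis+
  then have "bc_lam1 (inverse Z) = inverse (bc_lam1 Z)" "bc_lam2 (inverse Z) = inverse (bc_lam2 Z)"
    by (simp_all add: inverse_unique)
  then show "bc_lam1 (Z powi n) = bc_lam1 Z powi n" "bc_lam2 (Z powi n) = bc_lam2 Z powi n"
    by (simp_all add: power_int_def)
qed

text \<open>Separation of variables is taken as the definition instead of a series in
  \<open>Z\<close>: closure under sums and products is then inherited from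
  \<open>scalar_wiener\<close> in each component.\<close>

definition bc_scalar_wiener :: "(bicomplex \<Rightarrow> bicomplex) set" where
  "bc_scalar_wiener = {\<phi>. \<exists>g1\<in>scalar_wiener. \<exists>g2\<in>scalar_wiener. \<forall>Z\<in>bc_circle.
     bc_lam1 (\<phi> Z) = g1 (bc_lam1 Z) \<and> bc_lam2 (\<phi> Z) = g2 (bc_lam2 Z)}"

lemma bc_scalar_wienerI:
  assumes "g1 \<in> scalar_wiener" "g2 \<in> scalar_wiener"
    "\<And>Z. Z \<in> bc_circle \<Longrightarrow> bc_lam1 (\<phi> Z) = g1 (bc_lam1 Z)"
    "\<And>Z. Z \<in> bc_circle \<Longrightarrow> bc_lam2 (\<phi> Z) = g2 (bc_lam2 Z)"
  shows "\<phi> \<in> bc_scalar_wiener"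
  using assms unfolding bc_scalar_wiener_def by blast

lemma bc_scalar_wienerE:
  assumes "\<phi> \<in> bc_scalar_wiener"
  obtains g1 g2 where "g1 \<in> scalar_wiener" "g2 \<in> scalar_wiener"
    "\<And>Z. Z \<in> bc_circle \<Longrightarrow> bc_lam1 (\<phi> Z) = g1 (bc_lam1 Z)"
    "\<And>Z. Z \<in> bc_circle \<Longrightarrow> bc_lam2 (\<phi> Z) = g2 (bc_lam2 Z)"
  using assms unfolding bc_scalar_wiener_def by blast

lemma bc_scalar_wiener_cong:
  assumes "\<phi> \<in> bc_scalar_wiener" "\<And>Z. Z \<in> bc_circle \<Longrightarrow> \<phi> Z = \<psi> Z"
  shows "\<psi> \<in> bc_scalar_wiener"
  using assms unfolding bc_scalar_wiener_def by simp

lemma bc_scalar_wiener_const: "(\<lambda>Z. C) \<in> bc_scalar_wiener"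
  by (rule bc_scalar_wienerI[OF scalar_wiener_const[of "bc_lam1 C"] scalar_wiener_const[of "bc_lam2 C"]])
    simp_all

lemma bc_scalar_wiener_add:
  assumes "\<phi> \<in> bc_scalar_wiener" "\<psi> \<in> bc_scalar_wiener"
  shows "(\<lambda>Z. \<phi> Z + \<psi> Z) \<in> bc_scalar_wiener"
proof (rule bc_scalar_wienerE[OF assms(1)], rule bc_scalar_wienerE[OF assms(2)])
  fix f1 f2 g1 g2
  assume "f1 \<in> scalar_wiener" "f2 \<in> scalar_wiener" "g1 \<in> scalar_wiener" "g2 \<in> scalar_wiener"
    "\<And>Z. Z \<in> bc_circle \<Longrightarrow> bc_lam1 (\<phi> Z) = f1 (bc_lam1 Z)"
    "\<And>Z. Z \<in> bc_circle \<Longrightarrow> bc_lam2 (\<phi> Z) = f2 (bc_lam2 Z)"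
    "\<And>Z. Z \<in> bc_circle \<Longrightarrow> bc_lam1 (\<psi> Z) = g1 (bc_lam1 Z)"
    "\<And>Z. Z \<in> bc_circle \<Longrightarrow> bc_lam2 (\<psi> Z) = g2 (bc_lam2 Z)"
  then show ?thesis
    by (intro bc_scalar_wienerI[OF scalar_wiener_add[of f1 g1] scalar_wiener_add[of f2 g2]]) simp_all
qed

lemma bc_scalar_wiener_mult:
  assumes "\<phi> \<in> bc_scalar_wiener" "\<psi> \<in> bc_scalar_wiener"
  shows "(\<lambda>Z. \<phi> Z * \<psi> Z) \<in> bc_scalar_wiener"
proof (rule bc_scalar_wienerE[OF assms(1)], rule bc_scalar_wienerE[OF assms(2)])
  fix f1 f2 g1 g2
  assume "f1 \<in> scalar_wiener" "f2 \<in> scalar_wiener" "g1 \<in> scalar_wiener" "g2 \<in> scalar_wiener"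
    "\<And>Z. Z \<in> bc_circle \<Longrightarrow> bc_lam1 (\<phi> Z) = f1 (bc_lam1 Z)"
    "\<And>Z. Z \<in> bc_circle \<Longrightarrow> bc_lam2 (\<phi> Z) = f2 (bc_lam2 Z)"
    "\<And>Z. Z \<in> bc_circle \<Longrightarrow> bc_lam1 (\<psi> Z) = g1 (bc_lam1 Z)"
    "\<And>Z. Z \<in> bc_circle \<Longrightarrow> bc_lam2 (\<psi> Z) = g2 (bc_lam2 Z)"
  then show ?thesis
    by (intro bc_scalar_wienerI[OF scalar_wiener_mult[of f1 g1] scalar_wiener_mult[of f2 g2]]) simp_all
qed

lemma bc_scalar_wiener_sum:
  "(\<And>i. i \<in> I \<Longrightarrow> \<phi> i \<in> bc_scalar_wiener) \<Longrightarrow> (\<lambda>Z. \<Sum>i\<in>I. \<phi> i Z) \<in> bc_scalar_wiener"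
  by (induction I rule: infinite_finite_induct)
    (auto intro: bc_scalar_wiener_add bc_scalar_wiener_const)

text \<open>\<open>bc_mat_norm\<close> is a sum of two nonnegative operator norms, so it is summable
  exactly when both are.\<close>

lemma summable_bc_mat_norm_iff:
  "(\<lambda>n. bc_mat_norm (a n)) summable_on A \<longleftrightarrow>
    (\<forall>i k. (\<lambda>n. norm (bc_lam1 (a n $ i $ k))) summable_on A) \<and>
    (\<forall>i k. (\<lambda>n. norm (bc_lam2 (a n $ i $ k))) summable_on A)"
proof -
  have "(\<lambda>n. bc_mat_norm (a n)) summable_on A \<longleftrightarrow>
      (\<lambda>n. op_norm (\<chi> i k. bc_lam1 (a n $ i $ k))) summable_on A \<and>
      (\<lambda>n. op_norm (\<chi> i k. bc_lam2 (a n $ i $ k))) summable_on A" (is "?L \<longleftrightarrow> ?R1 \<and> ?R2")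
  proof (intro iffI conjI; (elim conjE)?)
    assume ?L
    then have "(\<lambda>n. norm (op_norm (\<chi> i k. bc_lam1 (a n $ i $ k)))) summable_on A"
      by (rule Infinite_Sum.abs_summable_on_comparison_test') (simp add: bc_mat_norm_def op_norm_nonneg)
    then show ?R1 by (simp add: op_norm_nonneg)
  next
    assume ?L
    then have "(\<lambda>n. norm (op_norm (\<chi> i k. bc_lam2 (a n $ i $ k)))) summable_on A"
      by (rule Infinite_Sum.abs_summable_on_comparison_test') (simp add: bc_mat_norm_def op_norm_nonneg)
    then show ?R2 by (simp add: op_norm_nonneg)
  next
    assume ?R1 ?R2
    then show ?L
      unfolding bc_mat_norm_def by (rule summable_on_add)
  qed
  then show ?thesis
    by (simp add: summable_op_norm_iff)
qed

text \<open>Idempotent components commute with powers of \<open>Z\<close> on the circle, so a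
  bicomplex Laurent series is a pair of independent complex ones, in \<open>bc_lam1 Z\<close> and in
  \<open>bc_lam2 Z\<close>.\<close>

lemma bc_wiener_set_iff:
  "f \<in> bc_wiener_set \<longleftrightarrow>
    f \<in> extensional bc_circle \<and> (\<forall>i k. (\<lambda>Z. f Z $ i $ k) \<in> bc_scalar_wiener)"
proof -
  have *: "((\<lambda>n. a n ** mat (Z powi n)) has_sum f Z) UNIV \<longleftrightarrow>
     (\<forall>i k. ((\<lambda>n. bc_lam1 (a n $ i $ k) * bc_lam1 Z powi n) has_sum bc_lam1 (f Z $ i $ k)) UNIV \<and>
            ((\<lambda>n. bc_lam2 (a n $ i $ k) * bc_lam2 Z powi n) has_sum bc_lam2 (f Z $ i $ k)) UNIV)"
    if "Z \<in> bc_circle" for Z and a :: "int \<Rightarrow> bicomplex^'a^'a"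
    using that by (simp add: has_sum_vec_iff matrix_mul_mat_nth has_sum_bicomplex_iff bc_lam_power_int)
  show ?thesis
  proof (intro iffI conjI allI; (elim conjE)?)
    assume f: "f \<in> bc_wiener_set"
    then show "f \<in> extensional bc_circle"
      unfolding bc_wiener_set_def by simp
    fix i k
    from f obtain a where a: "(\<lambda>n. bc_mat_norm (a n)) summable_on (UNIV :: int set)"
      "\<And>Z. Z \<in> bc_circle \<Longrightarrow> ((\<lambda>n. a n ** mat (Z powi n)) has_sum f Z) UNIV"
      unfolding bc_wiener_set_def by blast
    \<comment> \<open>The component functions are read off on the diagonal of the torus.\<close>
    define g1 where "g1 z = bc_lam1 (f (bc_of_complex z) $ i $ k)" for z
    define g2 where "g2 z = bc_lam2 (f (bc_of_complex z) $ i $ k)" for z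
    have g1: "((\<lambda>n. bc_lam1 (a n $ i $ k) * z powi n) has_sum g1 z) UNIV"
      and g2: "((\<lambda>n. bc_lam2 (a n $ i $ k) * z powi n) has_sum g2 z) UNIV"
      if "z \<in> sphere 0 1" for z
      using a(2)[of "bc_of_complex z"] bc_of_complex_in_bc_circle[OF that]
      by (simp_all add: * g1_def g2_def)
    show "(\<lambda>Z. f Z $ i $ k) \<in> bc_scalar_wiener"
    proof (rule bc_scalar_wienerI)
      show "g1 \<in> scalar_wiener"
        using g1 a(1) unfolding scalar_wiener_def summable_bc_mat_norm_iff mem_Collect_eq
        by (intro exI[of _ "\<lambda>n. bc_lam1 (a n $ i $ k)"]) simp
      show "g2 \<in> scalar_wiener"
        using g2 a(1) unfolding scalar_wiener_def summable_bc_mat_norm_iff mem_Collect_eq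
        by (intro exI[of _ "\<lambda>n. bc_lam2 (a n $ i $ k)"]) simp
    next
      \<comment> \<open>The series for the component at \<open>Z\<close> and the series for
        \<open>g1\<close> (or \<open>g2\<close>) at that coordinate are the same series, so
        uniqueness of sums identifies their values.\<close>
      fix Z assume Z: "Z \<in> bc_circle"
      show "bc_lam1 (f Z $ i $ k) = g1 (bc_lam1 Z)" "bc_lam2 (f Z $ i $ k) = g2 (bc_lam2 Z)"
        using a(2)[OF Z] g1[OF bc_circle_lam(1)[OF Z]] g2[OF bc_circle_lam(2)[OF Z]]
        unfolding *[OF Z] by (blast dest: has_sum_unique)+
    qed
  next
    assume ext: "f \<in> extensional bc_circle"
      and "\<forall>i k. (\<lambda>Z. f Z $ i $ k) \<in> bc_scalar_wiener"
    then obtain g1 g2 where g: "\<And>i k. g1 i k \<in> scalar_wiener" "\<And>i k. g2 i k \<in> scalar_wiener"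
      "\<And>i k Z. Z \<in> bc_circle \<Longrightarrow> bc_lam1 (f Z $ i $ k) = g1 i k (bc_lam1 Z)"
      "\<And>i k Z. Z \<in> bc_circle \<Longrightarrow> bc_lam2 (f Z $ i $ k) = g2 i k (bc_lam2 Z)"
      unfolding bc_scalar_wiener_def mem_Collect_eq by metis
    obtain a1 where a1: "\<And>i k. (\<lambda>n. norm (a1 i k n :: complex)) summable_on (UNIV :: int set)"
      "\<And>i k z. z \<in> sphere 0 1 \<Longrightarrow> ((\<lambda>n. a1 i k n * z powi n) has_sum g1 i k z) UNIV"
      using g(1) unfolding scalar_wiener_def mem_Collect_eq by metis
    obtain a2 where a2: "\<And>i k. (\<lambda>n. norm (a2 i k n :: complex)) summable_on (UNIV :: int set)"
      "\<And>i k z. z \<in> sphere 0 1 \<Longrightarrow> ((\<lambda>n. a2 i k n * z powi n) has_sum g2 i k z) UNIV"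
      using g(2) unfolding scalar_wiener_def mem_Collect_eq by metis
    \<comment> \<open>The two coefficient families are unrelated; joining them with
      \<open>bc_combine\<close> yields one bicomplex coefficient per exponent.\<close>
    define a :: "int \<Rightarrow> bicomplex^'a^'a" where "a n = (\<chi> i k. bc_combine (a1 i k n) (a2 i k n))" for n
    have "(\<lambda>n. bc_mat_norm (a n)) summable_on UNIV"
      unfolding summable_bc_mat_norm_iff a_def by (simp add: a1(1) a2(1))
    moreover have "((\<lambda>n. a n ** mat (Z powi n)) has_sum f Z) UNIV" if "Z \<in> bc_circle" for Z
      unfolding *[OF that]
      using a1(2)[OF bc_circle_lam(1)[OF that]] a2(2)[OF bc_circle_lam(2)[OF that]]
      by (simp add: a_def g(3,4)[OF that])
    ultimately show "f \<in> bc_wiener_set"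
      unfolding bc_wiener_set_def using ext by blast
  qed
qed


section \<open>Bicomplex matrices as sharp-symmetric complex matrices\<close>

definition bc_rep :: "bicomplex^'p^'p \<Rightarrow> complex^(2 \<times> 'p::finite)^(2 \<times> 'p)" where
  "bc_rep M = (\<chi> r c.
     if fst r = fst c then bc1 (M $ snd r $ snd c)
     else if fst r = 1 then - bc2 (M $ snd r $ snd c)
     else bc2 (M $ snd r $ snd c))"

text \<open>Only the first block column is read. This inverts \<open>bc_rep\<close> on the left
  always, on the right only for sharp-symmetric matrices.\<close>

definition bc_unrep :: "complex^(2 \<times> 'p::finite)^(2 \<times> 'p) \<Rightarrow> bicomplex^'p^'p" where
  "bc_unrep M = (\<chi> i k. Bicomplex (M $ (1, i) $ (1, k)) (M $ (2, i) $ (1, k)))"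

lemma bc_rep_nth [simp]:
  "bc_rep M $ (1, i) $ (1, k) = bc1 (M $ i $ k)"
  "bc_rep M $ (1, i) $ (2, k) = - bc2 (M $ i $ k)"
  "bc_rep M $ (2, i) $ (1, k) = bc2 (M $ i $ k)"
  "bc_rep M $ (2, i) $ (2, k) = bc1 (M $ i $ k)"
  by (simp_all add: bc_rep_def)

lemma block_matrix_eq_iff:
  fixes M N :: "'a^(2 \<times> 'p::finite)^(2 \<times> 'p)"
  shows "M = N \<longleftrightarrow> (\<forall>i k. M $ (1, i) $ (1, k) = N $ (1, i) $ (1, k) \<and>
      M $ (1, i) $ (2, k) = N $ (1, i) $ (2, k) \<and> M $ (2, i) $ (1, k) = N $ (2, i) $ (1, k) \<and>
      M $ (2, i) $ (2, k) = N $ (2, i) $ (2, k))"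
  unfolding vec_eq_iff split_paired_All forall_2 by blast

lemma sum_block: "(\<Sum>x\<in>UNIV. f x) = (\<Sum>i\<in>UNIV. f (1, i)) + (\<Sum>i\<in>UNIV. f (2, i))"
  for f :: "2 \<times> 'p::finite \<Rightarrow> 'a::comm_monoid_add"
proof -
  have "(\<Sum>x\<in>UNIV. f x) = (\<Sum>a\<in>UNIV. \<Sum>i\<in>UNIV. f (a, i))"
    by (simp add: sum.cartesian_product)
  then show ?thesis
    by (simp add: sum_2)
qed

lemma bc_unrep_rep [simp]: "bc_unrep (bc_rep M) = M"
  by (simp add: bc_unrep_def vec_eq_iff)

section \<open>Sharp symmetry in block form\<close>

lemma J_p_nth:
  "J_p $ (1, i) $ (1, k) = 0" "J_p $ (1, i) $ (2, k) = (if i = k then -1 else 0)"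
  "J_p $ (2, i) $ (1, k) = (if i = k then 1 else 0)" "J_p $ (2, i) $ (2, k) = 0"
  by (simp_all add: J_p_def kronecker_def J_matrix_def mat_def)

text \<open>\<open>J_p\<close> is a real signed permutation matrix, so conjugation by it only moves
  blocks and changes signs.\<close>

lemma sharp_nth:
  "sharp M $ (1, i) $ (1, k) = M $ (2, i) $ (2, k)"
  "sharp M $ (1, i) $ (2, k) = - M $ (2, i) $ (1, k)"
  "sharp M $ (2, i) $ (1, k) = - M $ (1, i) $ (2, k)"
  "sharp M $ (2, i) $ (2, k) = M $ (1, i) $ (1, k)"
  by (simp_all add: sharp_def matrix_matrix_mult_def sum_block J_p_nth conj_transpose_def
      if_distrib[of "\<lambda>x. x * _"] if_distrib[of "\<lambda>x. _ * x"] if_distrib[of cnj]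
      sum_negf cong: if_cong)

text \<open>Both sides say that the second block column is determined by the first: equal diagonal
  blocks and opposite off-diagonal ones. Sharp symmetry thereby becomes membership in the range of
  \<open>bc_rep\<close>.\<close>

lemma bc_rep_unrep_iff: "bc_rep (bc_unrep M) = M \<longleftrightarrow> M = sharp M"
  unfolding block_matrix_eq_iff sharp_nth bc_unrep_def by (auto simp: eq_commute)

lemma bc12_ring [simp]:
  "bc1 0 = 0" "bc2 0 = 0" "bc1 1 = 1" "bc2 1 = 0"
  "bc1 (Z + W) = bc1 Z + bc1 W" "bc2 (Z + W) = bc2 Z + bc2 W"
  "bc1 (Z * W) = bc1 Z * bc1 W - bc2 Z * bc2 W" "bc2 (Z * W) = bc1 Z * bc2 W + bc2 Z * bc1 W"
  by (simp_all add: bicomplex_ring_defs)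

lemma bc12_sum: "bc1 (\<Sum>i\<in>I. f i) = (\<Sum>i\<in>I. bc1 (f i))" "bc2 (\<Sum>i\<in>I. f i) = (\<Sum>i\<in>I. bc2 (f i))"
  by (induction I rule: infinite_finite_induct; simp)+

lemma bc_rep_add: "bc_rep (M + N) = bc_rep M + bc_rep N"
  unfolding block_matrix_eq_iff by simp

text \<open>The blocks describe left multiplication by A + jB on pairs (x, y) standing for x + jy,
  so products correspond; the proof compares the four blocks.\<close>

lemma bc_rep_mult: "bc_rep (M ** N) = bc_rep M ** bc_rep N"
  unfolding block_matrix_eq_iff
  by (simp add: matrix_matrix_mult_def sum_block bc12_sum sum.distrib sum_subtractf sum_negf)

lemma bc_rep_mat: "bc_rep (mat (bc_of_complex c)) = mat c"
  unfolding block_matrix_eq_iff by (simp add: mat_def bc_of_complex_def)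


section \<open>Pointwise algebras\<close>

lemma cring_complex_ring: "cring complex_ring"
proof (rule cringI)
  show "abelian_group complex_ring"
    by (rule abelian_groupI) (auto simp: complex_ring_def intro: exI[of _ "- _"])
  show "comm_monoid complex_ring"
    by (rule comm_monoidI) (auto simp: complex_ring_def)
qed (auto simp: complex_ring_def algebra_simps)

lemma mat_commute: "mat c ** M = M ** mat c" for M :: "'a::comm_semiring_1^'n^'n"
  by (simp add: vec_eq_iff mat_matrix_mul_nth matrix_mul_mat_nth mult.commute)

lemma matrix_add_rdistrib: "(A + B) ** C = A ** C + B ** C"
  for A B :: "'a::semiring_1^'n^'m"
  by (simp add: vec_eq_iff matrix_matrix_mult_def distrib_right sum.distrib)

text \<open>Scalars act through constant functions, so closure under scalar multiples and negatives
  follows from constants and products. Both Wiener algebras are instances, with different embeddings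
  \<open>\<iota>\<close>.\<close>

lemma complex_algebra_pointwise:
  fixes \<iota> :: "complex \<Rightarrow> 'a::comm_ring_1" and F :: "('z \<Rightarrow> 'a^'n^'n) set"
  assumes \<iota>: "\<iota> 1 = 1" "\<And>c d. \<iota> (c + d) = \<iota> c + \<iota> d" "\<And>c d. \<iota> (c * d) = \<iota> c * \<iota> d"
    and ext: "F \<subseteq> extensional D"
    and const: "\<And>c. (\<lambda>z\<in>D. mat (\<iota> c)) \<in> F"
    and add: "\<And>f g. f \<in> F \<Longrightarrow> g \<in> F \<Longrightarrow> (\<lambda>z\<in>D. f z + g z) \<in> F"
    and mult: "\<And>f g. f \<in> F \<Longrightarrow> g \<in> F \<Longrightarrow> (\<lambda>z\<in>D. f z ** g z) \<in> F"
  shows "complex_algebra (pointwise_algebra \<iota> D F)"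
proof -
  let ?A = "pointwise_algebra \<iota> D F"
  note sel = pointwise_algebra_def complex_ring_def
  have \<iota>0: "\<iota> 0 = 0" and \<iota>neg: "\<iota> (-1) = -1"
    using \<iota>(2)[of 0 0] \<iota>(2)[of 1 "-1"] \<iota>(1) by (simp_all add: eq_neg_iff_add_eq_0 add.commute)
  have mat0: "mat 0 = (0 :: 'a^'n^'n)"
    by (simp add: vec_eq_iff mat_def)
  have zero: "(\<lambda>z\<in>D. 0) \<in> F" and one: "(\<lambda>z\<in>D. mat 1) \<in> F"
    using const[of 0] const[of 1] by (simp_all add: \<iota>0 \<iota>(1) mat0)
  have smult: "(\<lambda>z\<in>D. mat (\<iota> c) ** f z) \<in> F" if "f \<in> F" for c f
    using mult[OF const[of c] that] by (simp cong: restrict_cong)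
  \<comment> \<open>The zero and unit laws return the restriction of \<open>f\<close> to
    \<open>D\<close>, which is \<open>f\<close> itself by extensionality.\<close>
  have restr: "(\<lambda>z\<in>D. f z) = f" if "f \<in> F" for f
    using that ext by (auto intro: extensional_restrict)
  have mat_add: "mat (a + b) = mat a + (mat b :: 'a^'n^'n)" for a b
    by (simp add: vec_eq_iff mat_def)
  have mat_mult: "mat (a * b) = mat a ** (mat b :: 'a^'n^'n)" for a b
    by (simp add: vec_eq_iff mat_matrix_mul_nth) (simp add: mat_def)
  have group: "abelian_group ?A"
  proof (rule abelian_groupI)
    fix f assume "f \<in> carrier ?A"
    then have f: "f \<in> F" by (simp add: sel)
    \<comment> \<open>The additive inverse of \<open>f\<close> is its multiple by the scalar
      -1.\<close>
    have "(\<lambda>z\<in>D. (\<lambda>z\<in>D. mat (\<iota> (-1)) ** f z) z + f z) = (\<lambda>z\<in>D. 0)"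
      by (auto simp: fun_eq_iff vec_eq_iff mat_matrix_mul_nth \<iota>neg restrict_def)
    then show "\<exists>g\<in>carrier ?A. g \<oplus>\<^bsub>?A\<^esub> f = \<zero>\<^bsub>?A\<^esub>"
      using smult[OF f, of "-1"] unfolding sel
      by (intro bexI[of _ "\<lambda>z\<in>D. mat (\<iota> (-1)) ** f z"]) simp_all
  qed (auto simp: sel add zero restr ac_simps cong: restrict_cong)
  have "monoid ?A"
    by (rule monoidI) (auto simp: sel mult one restr matrix_mul_assoc cong: restrict_cong)
  with group have "ring ?A"
    by (rule ringI)
      (auto simp: sel matrix_add_ldistrib matrix_add_rdistrib cong: restrict_cong)
  moreover have "Module.module complex_ring ?A"
    by (rule moduleI[OF cring_complex_ring group])
      (auto simp: sel smult restr \<iota> mat_add mat_mult matrix_add_ldistrib matrix_add_rdistrib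
        matrix_mul_assoc cong: restrict_cong)
  moreover have "mat c ** (M ** N) = M ** (mat c ** N)" for c and M N :: "'a^'n^'n"
    by (metis mat_commute matrix_mul_assoc)
  ultimately show ?thesis
    unfolding complex_algebra_def
    by (auto simp: sel matrix_mul_assoc[symmetric] cong: restrict_cong)
qed

section \<open>The two Wiener algebras as complex algebras\<close>

lemma complex_algebra_bc_wiener: "complex_algebra bc_wiener_algebra"
  unfolding bc_wiener_algebra_def
proof (rule complex_algebra_pointwise)
  show "bc_wiener_set \<subseteq> extensional bc_circle"
    by (auto simp: bc_wiener_set_iff)
  show "(\<lambda>Z\<in>bc_circle. mat (bc_of_complex c)) \<in> bc_wiener_set" for c
    by (auto simp: bc_wiener_set_iff intro: bc_scalar_wiener_cong[OF bc_scalar_wiener_const])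
  fix f g :: "bicomplex \<Rightarrow> bicomplex^'a^'a"
  assume "f \<in> bc_wiener_set" "g \<in> bc_wiener_set"
  then have f: "(\<lambda>Z. f Z $ i $ k) \<in> bc_scalar_wiener" and g: "(\<lambda>Z. g Z $ i $ k) \<in> bc_scalar_wiener"
    for i k by (auto simp: bc_wiener_set_iff)
  show "(\<lambda>Z\<in>bc_circle. f Z + g Z) \<in> bc_wiener_set"
    by (auto simp: bc_wiener_set_iff intro: bc_scalar_wiener_cong[OF bc_scalar_wiener_add[OF f g]])
  have "(\<lambda>Z. \<Sum>j\<in>UNIV. f Z $ i $ j * g Z $ j $ k) \<in> bc_scalar_wiener" for i k
    by (intro bc_scalar_wiener_sum bc_scalar_wiener_mult f g)
  from bc_scalar_wiener_cong[OF this]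
  show "(\<lambda>Z\<in>bc_circle. f Z ** g Z) \<in> bc_wiener_set"
    by (simp add: bc_wiener_set_iff matrix_matrix_mult_def)
qed (simp_all add: bc_eq_iff_lam)

lemma sharp_symmetric_iff: "sharp_symmetric f \<longleftrightarrow> (\<forall>z\<in>sphere 0 1. bc_rep (bc_unrep (f z)) = f z)"
  unfolding sharp_symmetric_def ball_sphere_iff_cis bc_rep_unrep_iff ..

lemma complex_algebra_sharp_symmetric_wiener: "complex_algebra sharp_symmetric_wiener_algebra"
  unfolding sharp_symmetric_wiener_algebra_def
proof (rule complex_algebra_pointwise; (elim CollectE conjE)?; (intro CollectI conjI)?)
  show "{f \<in> wiener_set. sharp_symmetric f} \<subseteq> extensional (sphere 0 1)"
    by (auto simp: wiener_set_iff)
  show "(\<lambda>z\<in>sphere 0 1. mat c) \<in> wiener_set" for c :: complex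
    by (auto simp: wiener_set_iff intro: scalar_wiener_cong[OF scalar_wiener_const])
  \<comment> \<open>Scalar matrices lie in the range of \<open>bc_rep\<close>, by
    \<open>bc_rep_mat\<close>.\<close>
  show "sharp_symmetric (\<lambda>z\<in>sphere 0 1. mat c)" for c
    by (simp add: sharp_symmetric_iff flip: bc_rep_mat)
  fix f g :: "complex \<Rightarrow> complex^(2 \<times> 'a)^(2 \<times> 'a)"
  assume "f \<in> wiener_set" "g \<in> wiener_set" and sym: "sharp_symmetric f" "sharp_symmetric g"
  then have f: "(\<lambda>z. f z $ i $ k) \<in> scalar_wiener" and g: "(\<lambda>z. g z $ i $ k) \<in> scalar_wiener"
    for i k unfolding wiener_set_iff by blast+
  show "(\<lambda>z\<in>sphere 0 1. f z + g z) \<in> wiener_set"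
    by (auto simp: wiener_set_iff intro: scalar_wiener_cong[OF scalar_wiener_add[OF f g]])
  have "(\<lambda>z. \<Sum>j\<in>UNIV. f z $ i $ j * g z $ j $ k) \<in> scalar_wiener" for i k
    by (intro scalar_wiener_sum scalar_wiener_mult f g)
  from scalar_wiener_cong[OF this]
  show "(\<lambda>z\<in>sphere 0 1. f z ** g z) \<in> wiener_set"
    by (simp add: wiener_set_iff matrix_matrix_mult_def)
  \<comment> \<open>Once the values are written in the range of \<open>bc_rep\<close>, their sums
    and products stay there because \<open>bc_rep\<close> is additive and multiplicative.\<close>
  have sym': "f z = bc_rep (bc_unrep (f z))" "g z = bc_rep (bc_unrep (g z))"
    if "z \<in> sphere 0 1" for z
    using sym that by (simp_all add: sharp_symmetric_iff)
  show "sharp_symmetric (\<lambda>z\<in>sphere 0 1. f z + g z)" "sharp_symmetric (\<lambda>z\<in>sphere 0 1. f z ** g z)"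
    unfolding sharp_symmetric_iff
    by (metis (no_types, lifting) restrict_apply' sym' bc_unrep_rep bc_rep_add bc_rep_mult)+
qed simp_all


section \<open>The isomorphism\<close>

definition wiener_iso ::
  "(bicomplex \<Rightarrow> bicomplex^'p^'p) \<Rightarrow> complex \<Rightarrow> complex^(2 \<times> 'p::finite)^(2 \<times> 'p)" where
  "wiener_iso f = (\<lambda>z\<in>sphere 0 1. bc_rep (f (bc_of_complex z)))"

text \<open>Each component of \<open>f Z\<close> depends on one coordinate only, and the complex
  number equal to that coordinate is a circle point with the same coordinate. Injectivity rests on
  this.\<close>

lemma bc_wiener_determined_on_complex_circle:
  assumes "f \<in> bc_wiener_set" "Z \<in> bc_circle"
  shows "f Z $ i $ k = bc_combine (bc_lam1 (f (bc_of_complex (bc_lam1 Z)) $ i $ k))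
    (bc_lam2 (f (bc_of_complex (bc_lam2 Z)) $ i $ k))"
proof -
  have "(\<lambda>Z. f Z $ i $ k) \<in> bc_scalar_wiener"
    using assms by (simp add: bc_wiener_set_iff)
  then show ?thesis
    using assms(2) bc_of_complex_in_bc_circle[OF bc_circle_lam(1)[OF assms(2)]]
      bc_of_complex_in_bc_circle[OF bc_circle_lam(2)[OF assms(2)]]
    by (auto simp: bc_eq_iff_lam elim!: bc_scalar_wienerE)
qed

lemma wiener_iso_in_sharp_symmetric:
  assumes "f \<in> bc_wiener_set"
  shows "wiener_iso f \<in> {g \<in> wiener_set. sharp_symmetric g}"
proof -
  have entry: "(\<lambda>z. bc1 (f (bc_of_complex z) $ i $ k)) \<in> scalar_wiener"
    "(\<lambda>z. bc2 (f (bc_of_complex z) $ i $ k)) \<in> scalar_wiener" for i k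
  proof -
    have "(\<lambda>Z. f Z $ i $ k) \<in> bc_scalar_wiener"
      using assms unfolding bc_wiener_set_iff by blast
    then obtain g1 g2 where g: "g1 \<in> scalar_wiener" "g2 \<in> scalar_wiener"
      "\<And>Z. Z \<in> bc_circle \<Longrightarrow> bc_lam1 (f Z $ i $ k) = g1 (bc_lam1 Z)"
      "\<And>Z. Z \<in> bc_circle \<Longrightarrow> bc_lam2 (f Z $ i $ k) = g2 (bc_lam2 Z)"
      unfolding bc_scalar_wiener_def by blast
    have val: "f (bc_of_complex z) $ i $ k = bc_combine (g1 z) (g2 z)" if "z \<in> sphere 0 1" for z
      using g(3,4)[OF bc_of_complex_in_bc_circle[OF that]] by (simp add: bc_eq_iff_lam)
    \<comment> \<open>These are the coordinates in the definition of \<open>bc_combine\<close>,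
      hence the entries of \<open>f\<close> along 1 and j.\<close>
    have "(\<lambda>z. 1/2 * (g1 z + g2 z)) \<in> scalar_wiener" "(\<lambda>z. \<i>/2 * (g1 z - g2 z)) \<in> scalar_wiener"
      by (intro scalar_wiener_mult scalar_wiener_const scalar_wiener_add scalar_wiener_diff g)+
    from this[THEN scalar_wiener_cong]
    show "(\<lambda>z. bc1 (f (bc_of_complex z) $ i $ k)) \<in> scalar_wiener"
      "(\<lambda>z. bc2 (f (bc_of_complex z) $ i $ k)) \<in> scalar_wiener"
      by (simp_all add: val bc_combine_def)
  qed
  have "(\<lambda>z. bc_rep (f (bc_of_complex z)) $ r $ c) \<in> scalar_wiener" for r c
    by (cases "fst r = fst c"; cases "fst r = 1")
      (simp_all add: bc_rep_def entry scalar_wiener_minus)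
  then have "(\<lambda>z. wiener_iso f z $ r $ c) \<in> scalar_wiener" for r c
    by (rule scalar_wiener_cong) (simp add: wiener_iso_def)
  then show ?thesis
    by (simp add: wiener_set_iff sharp_symmetric_iff) (simp add: wiener_iso_def)
qed

lemma wiener_iso_surj:
  assumes "g \<in> wiener_set" "sharp_symmetric g"
  shows "g \<in> wiener_iso ` bc_wiener_set"
proof
  \<comment> \<open>The idempotent components of \<open>bc_unrep (g z)\<close> are functions on the
    ordinary circle; evaluating each at its own coordinate extends them to the torus.\<close>
  define f where "f = (\<lambda>Z\<in>bc_circle. \<chi> i k.
    bc_combine (bc_lam1 (bc_unrep (g (bc_lam1 Z)) $ i $ k)) (bc_lam2 (bc_unrep (g (bc_lam2 Z)) $ i $ k)))"
  have g: "(\<lambda>z. g z $ r $ c) \<in> scalar_wiener" for r c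
    using assms(1) unfolding wiener_set_iff by blast
  have "(\<lambda>z. bc_lam1 (bc_unrep (g z) $ i $ k)) \<in> scalar_wiener"
    "(\<lambda>z. bc_lam2 (bc_unrep (g z) $ i $ k)) \<in> scalar_wiener" for i k
    unfolding bc_unrep_def bc_lam1_def bc_lam2_def vec_lambda_beta bicomplex.sel
    by (intro scalar_wiener_mult scalar_wiener_const scalar_wiener_add scalar_wiener_diff g)+
  then have "(\<lambda>Z. f Z $ i $ k) \<in> bc_scalar_wiener" for i k
    by (rule bc_scalar_wienerI) (simp_all add: f_def)
  then show "f \<in> bc_wiener_set"
    unfolding bc_wiener_set_iff by (simp add: f_def)
  show "g = wiener_iso f"
  proof (rule extensionalityI)
    show "g \<in> extensional (sphere 0 1)"
      using assms(1) by (simp add: wiener_set_iff)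
    show "wiener_iso f \<in> extensional (sphere 0 1)"
      by (simp add: wiener_iso_def)
    fix z :: complex assume z: "z \<in> sphere 0 1"
    \<comment> \<open>On the diagonal both coordinates are \<open>z\<close>, so the two components
      recombine; sharp symmetry of \<open>g\<close> then lets \<open>bc_rep\<close> undo
      \<open>bc_unrep\<close>.\<close>
    then have "f (bc_of_complex z) = bc_unrep (g z)"
      by (simp add: f_def bc_of_complex_in_bc_circle vec_eq_iff)
    then show "g z = wiener_iso f z"
      using z assms(2) by (simp add: wiener_iso_def sharp_symmetric_iff)
  qed
qed

lemma inj_on_wiener_iso: "inj_on wiener_iso bc_wiener_set"
proof (rule inj_onI)
  fix f g :: "bicomplex \<Rightarrow> bicomplex^'a^'a"
  assume f: "f \<in> bc_wiener_set" and g: "g \<in> bc_wiener_set" and eq: "wiener_iso f = wiener_iso g"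
  \<comment> \<open>\<open>bc_unrep\<close> recovers the restriction to the ordinary circle from the
    image.\<close>
  have *: "f (bc_of_complex z) = g (bc_of_complex z)" if "z \<in> sphere 0 1" for z
    using arg_cong[OF fun_cong[OF eq, of z], of bc_unrep] that by (simp add: wiener_iso_def)
  show "f = g"
  proof (rule extensionalityI)
    show "f \<in> extensional bc_circle" "g \<in> extensional bc_circle"
      using f g by (simp_all add: bc_wiener_set_iff)
    fix Z assume Z: "Z \<in> bc_circle"
    show "f Z = g Z"
      unfolding vec_eq_iff
        bc_wiener_determined_on_complex_circle[OF f Z] bc_wiener_determined_on_complex_circle[OF g Z]
      using *[OF bc_circle_lam(1)[OF Z]] *[OF bc_circle_lam(2)[OF Z]] by simp
  qed
qed

theorem theorem4p11:
  shows "algebra_isomorphic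
    (bc_wiener_algebra :: (complex, bicomplex \<Rightarrow> bicomplex^'p::finite^'p) module)
    (sharp_symmetric_wiener_algebra :: (complex, complex \<Rightarrow> complex^(2 \<times> 'p)^(2 \<times> 'p)) module)"
proof -
  let ?A = "bc_wiener_algebra :: (complex, bicomplex \<Rightarrow> bicomplex^'p^'p) module"
  let ?B = "sharp_symmetric_wiener_algebra :: (complex, complex \<Rightarrow> complex^(2 \<times> 'p)^(2 \<times> 'p)) module"
  note sel = bc_wiener_algebra_def sharp_symmetric_wiener_algebra_def pointwise_algebra_def
  have one: "bc_rep (mat 1) = (mat 1 :: complex^(2 \<times> 'p)^(2 \<times> 'p))"
    using bc_rep_mat[of 1] by (simp add: bc_of_complex_def one_bicomplex_def)
  \<comment> \<open>Restriction to the ordinary circle and \<open>bc_rep\<close> at each point both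
    respect the ring operations.\<close>
  have "wiener_iso \<in> ring_hom ?A ?B"
    using wiener_iso_in_sharp_symmetric
    by (intro ring_hom_memI)
      (auto simp: sel wiener_iso_def bc_of_complex_in_bc_circle bc_rep_add bc_rep_mult one
        cong: restrict_cong)
  moreover have "bij_betw wiener_iso (carrier ?A) (carrier ?B)"
    unfolding bij_betw_def using inj_on_wiener_iso wiener_iso_in_sharp_symmetric wiener_iso_surj
    by (auto simp: sel)
  \<comment> \<open>The scalar acts as \<open>mat (bc_of_complex c)\<close> on one side and as
    \<open>mat c\<close> on the other; \<open>bc_rep\<close> maps the first matrix to the
    second.\<close>
  moreover have "wiener_iso (c \<odot>\<^bsub>?A\<^esub> f) = c \<odot>\<^bsub>?B\<^esub> wiener_iso f" for c f
    by (auto simp: sel wiener_iso_def bc_of_complex_in_bc_circle bc_rep_mult bc_rep_mat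
        cong: restrict_cong)
  ultimately have "wiener_iso \<in> algebra_iso ?A ?B"
    unfolding algebra_iso_def ring_iso_def by simp
  then show ?thesis
    unfolding algebra_isomorphic_def
    using complex_algebra_bc_wiener complex_algebra_sharp_symmetric_wiener by blast
qed

end
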